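(* Let $(a_i)$ be a computable increasing sequence of rational numbers converging to a Martin-Löf random real $\alpha$, and let $N(\varepsilon)$ be its modulus of convergence. Then there is a constant $c$ such that $N(2^{-k})\ge BP'(k-c)$ for all natural numbers $k$.
   Context: The modulus of convergence $N(\varepsilon)$ is the minimal $N$ such that $|\alpha-a_n|<\varepsilon$ for all $n>N$. Fix a universal lower semicomputable semimeasure $m$ on $\mathbb{N}$ (a priori probability): a function $m:\mathbb{N}\to[0,\infty)$, lower semicomputable uniformly in its argument, with $\sum_n m(n)\le 1$, such that every such function is bounded by $c\,m$ for some constant $c$. For an integer $k$, $BP'(k)$ is the minimal $N$ such that $\sum_{n>N} m(n)<2^{-k}$. *)

theory Defs
  imports "HOL-Analysis.Analysis"
begin

datatype recf =
    Zero
  | Succ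
  | Proj nat
  | Comp recf "recf list"
  | PrimRec recf recf
  | Mu recf

text \<open>\<open>evaluates f xs y\<close>: the partial recursive function described by \<open>f\<close> is defined on the
  argument list \<open>xs\<close> and has value \<open>y\<close> there. The recursion variable of \<^term>\<open>PrimRec f g\<close>
  and the search variable of \<^term>\<open>Mu f\<close> come first; \<open>Mu\<close> requires \<open>f\<close> to be defined (and nonzero)
  at all arguments below the one found.\<close>

inductive evaluates :: "recf \<Rightarrow> nat list \<Rightarrow> nat \<Rightarrow> bool" where
  eval_Zero: "evaluates Zero xs 0"
| eval_Succ: "evaluates Succ [x] (Suc x)"
| eval_Proj: "i < length xs \<Longrightarrow> evaluates (Proj i) xs (xs ! i)"
| eval_Comp: "list_all2 (\<lambda>g y. evaluates g xs y) gs ys \<Longrightarrow> evaluates f ys z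
    \<Longrightarrow> evaluates (Comp f gs) xs z"
| eval_PrimRec_0: "evaluates f xs y \<Longrightarrow> evaluates (PrimRec f g) (0 # xs) y"
| eval_PrimRec_Suc: "evaluates (PrimRec f g) (n # xs) y \<Longrightarrow> evaluates g (n # y # xs) z
    \<Longrightarrow> evaluates (PrimRec f g) (Suc n # xs) z"
| eval_Mu: "evaluates f (n # xs) 0 \<Longrightarrow> (\<And>i. i < n \<Longrightarrow> \<exists>y. y \<noteq> 0 \<and> evaluates f (i # xs) y)
    \<Longrightarrow> evaluates (Mu f) xs n"

inductive_cases evaluates_elims:
  "evaluates Zero xs y" "evaluates Succ xs y" "evaluates (Proj i) xs y"
  "evaluates (Comp f gs) xs y" "evaluates (PrimRec f g) (0 # xs) y"
  "evaluates (PrimRec f g) (Suc n # xs) y" "evaluates (Mu f) xs y"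

lemma evaluates_deterministic:
  "evaluates f xs y \<Longrightarrow> evaluates f xs z \<Longrightarrow> y = z"
proof (induction arbitrary: z rule: evaluates.induct)
  case (eval_Comp xs gs ys f w)
  from eval_Comp.prems obtain ys' where
    ys': "list_all2 (\<lambda>g y. evaluates g xs y) gs ys'" "evaluates f ys' z"
    by (auto elim: evaluates_elims)
  have "ys = ys'"
    using eval_Comp.IH(1) ys'(1)
    by (auto simp: list_all2_conv_all_nth intro!: nth_equalityI)
  with ys'(2) eval_Comp.IH(2) show ?case by blast
next
  case (eval_Mu f n xs)
  from eval_Mu.prems have z: "evaluates f (z # xs) 0"
    "\<And>i. i < z \<Longrightarrow> \<exists>y. y \<noteq> 0 \<and> evaluates f (i # xs) y"
    by (auto elim: evaluates_elims)
  show ?case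
  proof (rule linorder_cases[of n z])
    assume "n < z"
    then show ?thesis using z(2) eval_Mu.IH(1) by blast
  next
    assume "z < n"
    then show ?thesis using z(1) eval_Mu.IH(2) by blast
  qed
qed (blast elim: evaluates_elims)+

definition computable :: "nat \<Rightarrow> (nat list \<Rightarrow> nat) \<Rightarrow> bool" where
  "computable k f \<longleftrightarrow> (\<exists>r. \<forall>xs. length xs = k \<longrightarrow> evaluates r xs (f xs))"

definition computable_rat :: "nat \<Rightarrow> (nat list \<Rightarrow> rat) \<Rightarrow> bool" where
  "computable_rat k f \<longleftrightarrow> (\<exists>p q d. computable k p \<and> computable k q \<and> computable k d \<and>
     (\<forall>xs. length xs = k \<longrightarrow>
        f xs = (of_nat (p xs) - of_nat (q xs)) / of_nat (Suc (d xs))))"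

definition computable_rat_seq :: "(nat \<Rightarrow> rat) \<Rightarrow> bool" where
  "computable_rat_seq a \<longleftrightarrow> computable_rat 1 (\<lambda>xs. a (xs ! 0))"

definition computable_rat_seq2 :: "(nat \<Rightarrow> nat \<Rightarrow> rat) \<Rightarrow> bool" where
  "computable_rat_seq2 a \<longleftrightarrow> computable_rat 2 (\<lambda>xs. a (xs ! 0) (xs ! 1))"

definition martin_loef_test :: "(nat \<Rightarrow> real set) \<Rightarrow> bool" where
  "martin_loef_test U \<longleftrightarrow>
     (\<exists>l r. computable_rat_seq2 l \<and> computable_rat_seq2 r \<and>
        (\<forall>n. U n = (\<Union>i. {of_rat (l n i)<..<of_rat (r n i)}))) \<and>
     (\<forall>n. emeasure lborel (U n) \<le> ennreal (1 / 2 ^ n))"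

definition martin_loef_random :: "real \<Rightarrow> bool" where
  "martin_loef_random \<alpha> \<longleftrightarrow> (\<forall>U. martin_loef_test U \<longrightarrow> \<alpha> \<notin> (\<Inter>n. U n))"

definition lower_semicomputable :: "(nat \<Rightarrow> real) \<Rightarrow> bool" where
  "lower_semicomputable m \<longleftrightarrow>
     (\<exists>q. computable_rat_seq2 q \<and>
        (\<forall>n. incseq (q n) \<and> (\<lambda>s. of_rat (q n s)) \<longlonglongrightarrow> m n))"

definition lower_semicomputable_semimeasure :: "(nat \<Rightarrow> real) \<Rightarrow> bool" where
  "lower_semicomputable_semimeasure m \<longleftrightarrow>
     lower_semicomputable m \<and> (\<forall>n. 0 \<le> m n) \<and>
     m summable_on UNIV \<and> (\<Sum>\<^sub>\<infinity>n. m n) \<le> 1"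

definition universal_semimeasure :: "(nat \<Rightarrow> real) \<Rightarrow> bool" where
  "universal_semimeasure m \<longleftrightarrow>
     lower_semicomputable_semimeasure m \<and>
     (\<forall>m'. lower_semicomputable_semimeasure m' \<longrightarrow> (\<exists>c. \<forall>n. m' n \<le> c * m n))"

definition BP' :: "(nat \<Rightarrow> real) \<Rightarrow> int \<Rightarrow> nat" where
  "BP' m k = (LEAST N. (\<Sum>\<^sub>\<infinity>n\<in>{N<..}. m n) < 2 powi (- k))"

definition modulus_of_convergence :: "(nat \<Rightarrow> real) \<Rightarrow> real \<Rightarrow> real \<Rightarrow> nat" where
  "modulus_of_convergence a \<alpha> \<epsilon> = (LEAST N. \<forall>n>N. \<bar>\<alpha> - a n\<bar> < \<epsilon>)"

end

theory Submission
  imports Defs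
begin

text \<open>Replace the approximations of \<open>m(n)\<close> by ones in which \<open>m(n)\<close> still counts as \<open>0\<close> up to
  stage \<open>n + 1\<close>. The total mass \<open>c\<^sub>s\<close> present at stage \<open>s\<close> is then a computable increasing sequence
  with limit \<open>\<beta> = \<Sum> m(n)\<close>, and \<open>\<Sum>\<^bsub>n>N\<^esub> m(n)\<close> is at most the mass \<open>\<beta> - c\<^sub>s\<close> missing at
  stage \<open>s = N + 2\<close>. So it suffices that \<open>\<beta> - c\<^sub>s\<^sub>+\<^sub>1 \<le> C (\<alpha> - a\<^sub>s)\<close> for some constant \<open>C\<close> and all \<open>s\<close>.

  This holds for random \<open>\<alpha>\<close>, by a variant of the argument of Kucera and Slaman. For \<open>\<epsilon> > 0\<close> put
  \<open>g\<^sub>s = a\<^sub>s - \<epsilon> c\<^sub>s\<^sub>+\<^sub>1\<close>, with limit \<open>\<alpha> - \<epsilon> \<beta>\<close>, and let \<open>R\<^sub>s\<close> be the maximum of \<open>g\<^sub>0, \<dots>, g\<^sub>s\<close>. The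
  intervals from \<open>R\<^sub>s + \<epsilon> c\<^sub>s\<close> to \<open>R\<^sub>s + \<epsilon> c\<^sub>s\<^sub>+\<^sub>2\<close> have total length at most \<open>2 \<epsilon> (\<beta> - c\<^sub>0)\<close>.
  If some \<open>g\<^sub>s\<close> exceeds the limit, then \<open>R\<close> is eventually constant, the corresponding intervals cover
  everything from \<open>a\<^sub>t\<close> (where \<open>g\<^sub>t\<close> is the maximum) up to \<open>R + \<epsilon> \<beta> > \<alpha>\<close>, and so they catch \<open>\<alpha>\<close>. With
  \<open>\<epsilon>\<close> running through powers of \<open>1/2\<close> this is a Martin-Loef test, so for some \<open>\<epsilon>\<close> every \<open>g\<^sub>s\<close>
  is at most \<open>\<alpha> - \<epsilon> \<beta>\<close>, which is the required inequality with \<open>C = 1/\<epsilon>\<close>.\<close>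

section \<open>Computable functions\<close>

lemma computable_cong:
  assumes "computable k f" "\<And>xs. length xs = k \<Longrightarrow> f xs = g xs"
  shows "computable k g"
  using assms unfolding computable_def by metis

lemma computable_comp:
  assumes f: "computable (length gs) f" and gs: "\<And>g. g \<in> set gs \<Longrightarrow> computable k g"
  shows "computable k (\<lambda>xs. f (map (\<lambda>g. g xs) gs))"
proof -
  obtain r where r: "\<And>ys. length ys = length gs \<Longrightarrow> evaluates r ys (f ys)"
    using f unfolding computable_def by blast
  have "\<forall>g. \<exists>s. g \<in> set gs \<longrightarrow> (\<forall>xs. length xs = k \<longrightarrow> evaluates s xs (g xs))"
    using gs unfolding computable_def by blast
  then obtain s where s: "\<And>g xs. g \<in> set gs \<Longrightarrow> length xs = k \<Longrightarrow> evaluates (s g) xs (g xs)"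
    by metis
  have "evaluates (Comp r (map s gs)) xs (f (map (\<lambda>g. g xs) gs))" if "length xs = k" for xs
  proof (rule eval_Comp)
    show "list_all2 (\<lambda>g y. evaluates g xs y) (map s gs) (map (\<lambda>g. g xs) gs)"
      using s that by (auto simp: list_all2_conv_all_nth)
  qed (simp add: r)
  then show ?thesis unfolding computable_def by blast
qed

lemma computable_proj: "i < k \<Longrightarrow> computable k (\<lambda>xs. xs ! i)"
  unfolding computable_def by (auto intro!: exI[of _ "Proj i"] eval_Proj)

lemma computable_hd: "computable (Suc k) hd"
  by (rule computable_cong[OF computable_proj[of 0]]) (auto simp: length_Suc_conv)

lemma computable_tl_nth: "i < k \<Longrightarrow> computable (Suc k) (\<lambda>xs. tl xs ! i)"
  by (rule computable_cong[OF computable_proj[of "Suc i"]]) (auto simp: nth_tl)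

lemma computable_comp1:
  assumes "computable 1 (\<lambda>xs. f (xs ! 0))" "computable k g"
  shows "computable k (\<lambda>xs. f (g xs))"
  using computable_comp[of "[g]" "\<lambda>xs. f (xs ! 0)" k] assms by simp

lemma computable_Suc: "computable k f \<Longrightarrow> computable k (\<lambda>xs. Suc (f xs))"
proof (rule computable_comp1[where f = Suc])
  show "computable 1 (\<lambda>xs. Suc (xs ! 0))"
    unfolding computable_def by (auto simp: length_Suc_conv intro!: exI[of _ Succ] eval_Succ)
qed

lemma computable_const: "computable k (\<lambda>_. n)"
proof (induction n)
  case 0
  then show ?case unfolding computable_def by (auto intro!: exI[of _ Zero] eval_Zero)
qed (rule computable_Suc)

text \<open>\<open>PrimRec\<close> expects the recursion variable in front of the parameters, so it
  is composed with \<open>N\<close> followed by all \<open>k\<close> projections.\<close>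

lemma computable_rec_nat:
  assumes f: "computable k f" and g: "computable (Suc (Suc k)) (\<lambda>ys. g (hd ys) (hd (tl ys)) (tl (tl ys)))"
    and N: "computable k N"
  shows "computable k (\<lambda>xs. rec_nat (f xs) (\<lambda>n y. g n y xs) (N xs))"
proof -
  let ?P = "\<lambda>ys. rec_nat (f (tl ys)) (\<lambda>n y. g n y (tl ys)) (hd ys)"
  obtain r where r: "\<And>xs. length xs = k \<Longrightarrow> evaluates r xs (f xs)"
    using f unfolding computable_def by blast
  obtain s where "\<And>ys. length ys = Suc (Suc k) \<Longrightarrow> evaluates s ys (g (hd ys) (hd (tl ys)) (tl (tl ys)))"
    using g unfolding computable_def by blast
  then have s: "evaluates s (n # y # xs) (g n y xs)" if "length xs = k" for n y xs
    using that by (metis length_Cons list.sel(1,3))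
  have P: "evaluates (PrimRec r s) (n # xs) (rec_nat (f xs) (\<lambda>n y. g n y xs) n)"
    if "length xs = k" for n xs
    using that by (induction n) (auto intro: eval_PrimRec_0 eval_PrimRec_Suc r s)
  then have "computable (Suc k) ?P"
    unfolding computable_def by (auto simp: length_Suc_conv intro!: exI[of _ "PrimRec r s"])
  then have "computable k (\<lambda>xs. ?P (map (\<lambda>g. g xs) (N # map (\<lambda>i xs. xs ! i) [0..<k])))"
    by (intro computable_comp) (auto simp: N intro: computable_proj)
  then show ?thesis
    by (rule computable_cong) (auto simp: o_def map_nth)
qed

text \<open>Serves recursions for sums and products: the step receives the accumulated value as
  second entry, and the summand or factor has to skip it.\<close>

lemma computable_drop_arg:
  assumes "computable (Suc k) (\<lambda>ys. F (hd ys) (tl ys))"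
  shows "computable (Suc (Suc k)) (\<lambda>ys. F (hd ys) (tl (tl ys)))"
proof -
  let ?gs = "(\<lambda>ys. ys ! 0) # map (\<lambda>i ys. ys ! Suc (Suc i)) [0..<k]"
  have "computable (Suc (Suc k)) (\<lambda>xs. (\<lambda>ys. F (hd ys) (tl ys)) (map (\<lambda>g. g xs) ?gs))"
    using assms by (intro computable_comp) (auto intro!: computable_proj)
  then show ?thesis
  proof (rule computable_cong)
    fix xs :: "nat list" assume "length xs = Suc (Suc k)"
    then obtain x y zs where "xs = x # y # zs" "length zs = k" by (auto simp: length_Suc_conv)
    then show "F (hd (map (\<lambda>g. g xs) ?gs)) (tl (map (\<lambda>g. g xs) ?gs)) = F (hd xs) (tl (tl xs))"
      by (auto simp: o_def map_nth)
  qed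
qed

section \<open>Arithmetic on natural numbers\<close>

lemma computable_hd_tl: "computable (Suc (Suc k)) (\<lambda>xs. hd (tl xs))"
  by (rule computable_cong[OF computable_proj[of 1]]) (auto simp: length_Suc_conv)

lemma computable_add:
  assumes "computable k f" "computable k g"
  shows "computable k (\<lambda>xs. f xs + g xs)"
proof -
  have "computable k (\<lambda>xs. rec_nat (f xs) (\<lambda>n y. Suc y) (g xs))"
    using assms by (intro computable_rec_nat computable_Suc computable_hd_tl)
  moreover have "rec_nat x (\<lambda>n y. Suc y) z = x + z" for x z :: nat by (induction z) auto
  ultimately show ?thesis by simp
qed

lemma computable_sum:
  assumes "computable (Suc k) (\<lambda>ys. F (hd ys) (tl ys))" "computable k N"
  shows "computable k (\<lambda>xs. \<Sum>i<N xs. F i xs)"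
proof -
  have "computable k (\<lambda>xs. rec_nat 0 (\<lambda>n y. y + F n xs) (N xs))"
    using assms
    by (intro computable_rec_nat computable_add computable_hd_tl computable_drop_arg computable_const)
  moreover have "rec_nat 0 (\<lambda>n y. y + F n xs) z = (\<Sum>i<z. F i xs)" for z xs by (induction z) auto
  ultimately show ?thesis by simp
qed

lemma computable_tl:
  assumes "computable k f"
  shows "computable (Suc k) (\<lambda>ys. f (tl ys))"
proof -
  have "computable (Suc k) (\<lambda>xs. f (map (\<lambda>g. g xs) (map (\<lambda>i ys. ys ! Suc i) [0..<k])))"
    using assms by (intro computable_comp) (auto intro!: computable_proj)
  then show ?thesis
    by (rule computable_cong) (auto simp: o_def map_nth length_Suc_conv)
qed

lemma computable_mult:
  assumes "computable k f" "computable k g"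
  shows "computable k (\<lambda>xs. f xs * g xs)"
proof -
  have "computable k (\<lambda>xs. \<Sum>i<f xs. g xs)"
    using assms by (intro computable_sum computable_tl)
  then show ?thesis by simp
qed

lemma computable_prod:
  assumes "computable (Suc k) (\<lambda>ys. F (hd ys) (tl ys))" "computable k N"
  shows "computable k (\<lambda>xs. \<Prod>i<N xs. F i xs)"
proof -
  have "computable k (\<lambda>xs. rec_nat 1 (\<lambda>n y. y * F n xs) (N xs))"
    using assms
    by (intro computable_rec_nat computable_mult computable_hd_tl computable_drop_arg computable_const)
  moreover have "rec_nat 1 (\<lambda>n y. y * F n xs) z = (\<Prod>i<z. F i xs)" for z xs by (induction z) auto
  ultimately show ?thesis by simp
qed

lemma computable_power:
  assumes "computable k f" "computable k g"
  shows "computable k (\<lambda>xs. f xs ^ g xs)"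
proof -
  have "computable k (\<lambda>xs. \<Prod>i<g xs. f xs)"
    using assms by (intro computable_prod computable_tl)
  then show ?thesis by simp
qed

lemma computable_pred:
  assumes "computable k f"
  shows "computable k (\<lambda>xs. f xs - 1)"
proof -
  have "computable k (\<lambda>xs. rec_nat 0 (\<lambda>n y. n) (f xs))"
    using assms by (intro computable_rec_nat computable_const computable_hd)
  moreover have "rec_nat 0 (\<lambda>n y. n) z = z - 1" for z by (cases z) auto
  ultimately show ?thesis by simp
qed

lemma computable_diff:
  assumes "computable k f" "computable k g"
  shows "computable k (\<lambda>xs. f xs - g xs)"
proof -
  have "computable k (\<lambda>xs. rec_nat (f xs) (\<lambda>n y. y - 1) (g xs))"
    using assms by (intro computable_rec_nat computable_pred computable_hd_tl)
  moreover have "rec_nat x (\<lambda>n y. y - 1) z = x - z" for x z :: nat by (induction z) auto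
  ultimately show ?thesis by simp
qed

lemma computable_if_less:
  assumes "computable k f" "computable k g" "computable k u" "computable k v"
  shows "computable k (\<lambda>xs. if f xs < g xs then u xs else v xs)"
proof -
  \<comment> \<open>By truncated subtraction \<open>?s xs\<close> is 0 if \<open>f xs < g xs\<close>
    and 1 otherwise.\<close>
  let ?s = "\<lambda>xs. 1 - (g xs - f xs)"
  have "computable k (\<lambda>xs. u xs * (1 - ?s xs) + v xs * ?s xs)"
    using assms by (intro computable_add computable_mult computable_diff computable_const)
  then show ?thesis by (rule computable_cong) auto
qed

text \<open>The quotient is the number of \<open>i\<close> with
  \<open>Suc i * g xs \<le> f xs\<close>. All of these lie below \<open>f xs\<close>, so a bounded
  sum counts them.\<close>

lemma computable_div:
  assumes "computable k f" "computable k g" "\<And>xs. length xs = k \<Longrightarrow> 0 < g xs"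
  shows "computable k (\<lambda>xs. f xs div g xs)"
proof -
  have "computable k (\<lambda>xs. \<Sum>i<f xs. if f xs < Suc i * g xs then 0 else 1)"
    using assms(1,2)
    by (intro computable_sum computable_if_less computable_mult computable_tl computable_const
        computable_Suc computable_hd)
  then show ?thesis
  proof (rule computable_cong)
    fix xs :: "nat list" assume "length xs = k"
    then have g: "0 < g xs" by (rule assms)
    have quot: "\<not> f xs < Suc i * g xs \<longleftrightarrow> i < f xs div g xs" for i
      using less_eq_div_iff_mult_less_eq[OF g, of "Suc i" "f xs"] by (metis Suc_le_eq not_less)
    have "(\<Sum>i<f xs. if f xs < Suc i * g xs then 0 else 1)
        = (\<Sum>i<f xs. if i < f xs div g xs then 1 else 0)"
      using quot by (intro sum.cong) auto
    also have "\<dots> = card ({..<f xs} \<inter> {i. i < f xs div g xs})"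
      by (simp add: sum.If_cases)
    also have "{..<f xs} \<inter> {i. i < f xs div g xs} = {..<f xs div g xs}"
      by (auto intro: less_le_trans[OF _ div_le_dividend])
    finally show "(\<Sum>i<f xs. if f xs < Suc i * g xs then 0 else 1) = f xs div g xs"
      by simp
  qed
qed

lemmas computable_intros = computable_proj computable_hd computable_tl_nth computable_tl
  computable_const computable_Suc computable_add computable_mult computable_power computable_diff
  computable_if_less

section \<open>Computable rational functions\<close>

lemma computable_ratI:
  assumes "computable k p" "computable k q" "computable k d"
    "\<And>xs. length xs = k \<Longrightarrow> f xs = (of_nat (p xs) - of_nat (q xs)) / of_nat (Suc (d xs))"
  shows "computable_rat k f"
  using assms unfolding computable_rat_def by blast

lemma computable_ratE:
  assumes "computable_rat k f"
  obtains p q d where "computable k p" "computable k q" "computable k d"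
    "\<And>xs. length xs = k \<Longrightarrow> f xs = (of_nat (p xs) - of_nat (q xs)) / of_nat (Suc (d xs))"
  using assms unfolding computable_rat_def by blast

lemma computable_rat_cong:
  assumes "computable_rat k f" "\<And>xs. length xs = k \<Longrightarrow> f xs = g xs"
  shows "computable_rat k g"
  using assms unfolding computable_rat_def by metis

lemma computable_rat_comp:
  assumes f: "computable_rat (length gs) f" and gs: "\<And>g. g \<in> set gs \<Longrightarrow> computable k g"
  shows "computable_rat k (\<lambda>xs. f (map (\<lambda>g. g xs) gs))"
  using f by (rule computable_ratE) (rule computable_ratI; (rule computable_comp[OF _ gs])?; simp)

lemma computable_rat_seq_comp:
  assumes "computable_rat_seq a" "computable k g"
  shows "computable_rat k (\<lambda>xs. a (g xs))"
  using computable_rat_comp[of "[g]" "\<lambda>xs. a (xs ! 0)" k] assms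
  by (simp add: computable_rat_seq_def)

lemma computable_rat_seq2_comp:
  assumes "computable_rat_seq2 a" "computable k g" "computable k h"
  shows "computable_rat k (\<lambda>xs. a (g xs) (h xs))"
  using computable_rat_comp[of "[g, h]" "\<lambda>xs. a (xs ! 0) (xs ! 1)" k] assms
  by (auto simp: computable_rat_seq2_def numeral_2_eq_2)

lemma computable_rat_inverse_of_nat:
  assumes f: "computable k f" and pos: "\<And>xs. length xs = k \<Longrightarrow> 0 < f xs"
  shows "computable_rat k (\<lambda>xs. 1 / of_nat (f xs))"
  by (rule computable_ratI[where p = "\<lambda>_. 1" and q = "\<lambda>_. 0" and d = "\<lambda>xs. f xs - 1"])
    (use f pos in \<open>auto intro!: computable_intros simp: of_nat_Suc[symmetric] simp del: of_nat_Suc\<close>)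

lemma computable_rat_uminus:
  assumes "computable_rat k f"
  shows "computable_rat k (\<lambda>xs. - f xs)"
  using assms by (rule computable_ratE) (rule computable_ratI, assumption+, simp add: minus_divide_left)

lemma computable_rat_add:
  assumes "computable_rat k f" "computable_rat k g"
  shows "computable_rat k (\<lambda>xs. f xs + g xs)"
proof -
  obtain p q d where f: "computable k p" "computable k q" "computable k d"
    "\<And>xs. length xs = k \<Longrightarrow> f xs = (of_nat (p xs) - of_nat (q xs)) / of_nat (Suc (d xs))"
    using assms(1) unfolding computable_rat_def by blast
  obtain p' q' d' where g: "computable k p'" "computable k q'" "computable k d'"
    "\<And>xs. length xs = k \<Longrightarrow> g xs = (of_nat (p' xs) - of_nat (q' xs)) / of_nat (Suc (d' xs))"
    using assms(2) unfolding computable_rat_def by blast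
  have *: "(p - q) / D + (p' - q') / D' = ((p * D' + p' * D) - (q * D' + q' * D)) / (D * D')"
    if "D > 0" "D' > 0" for p q p' q' D D' :: rat
    using that by (simp add: field_simps)
  show ?thesis
  proof (rule computable_ratI)
    show "f xs + g xs = (of_nat (p xs * Suc (d' xs) + p' xs * Suc (d xs))
        - of_nat (q xs * Suc (d' xs) + q' xs * Suc (d xs)))
        / of_nat (Suc (d xs * d' xs + d xs + d' xs))" if "length xs = k" for xs
    proof -
      have "Suc (d xs * d' xs + d xs + d' xs) = Suc (d xs) * Suc (d' xs)" by simp
      then show ?thesis
        unfolding f(4)[OF that] g(4)[OF that] of_nat_add
        by (subst *) (simp_all only: of_nat_mult of_nat_add of_nat_0_less_iff zero_less_Suc)
    qed
  qed (intro computable_intros f g)+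
qed

lemma computable_rat_diff:
  assumes "computable_rat k f" "computable_rat k g"
  shows "computable_rat k (\<lambda>xs. f xs - g xs)"
  using computable_rat_add[OF assms(1) computable_rat_uminus[OF assms(2)]] by simp

lemma computable_rat_mult:
  assumes "computable_rat k f" "computable_rat k g"
  shows "computable_rat k (\<lambda>xs. f xs * g xs)"
proof -
  obtain p q d where f: "computable k p" "computable k q" "computable k d"
    "\<And>xs. length xs = k \<Longrightarrow> f xs = (of_nat (p xs) - of_nat (q xs)) / of_nat (Suc (d xs))"
    using assms(1) unfolding computable_rat_def by blast
  obtain p' q' d' where g: "computable k p'" "computable k q'" "computable k d'"
    "\<And>xs. length xs = k \<Longrightarrow> g xs = (of_nat (p' xs) - of_nat (q' xs)) / of_nat (Suc (d' xs))"
    using assms(2) unfolding computable_rat_def by blast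
  show ?thesis
  proof (rule computable_ratI)
    show "f xs * g xs = (of_nat (p xs * p' xs + q xs * q' xs) - of_nat (p xs * q' xs + q xs * p' xs))
        / of_nat (Suc (d xs * d' xs + d xs + d' xs))" if "length xs = k" for xs
    proof -
      have *: "Suc (d xs * d' xs + d xs + d' xs) = Suc (d xs) * Suc (d' xs)" by simp
      show ?thesis
        unfolding f(4)[OF that] g(4)[OF that] * of_nat_add of_nat_mult
        by (simp only: times_divide_times_eq) (simp add: algebra_simps)
    qed
  qed (intro computable_intros f g)+
qed

text \<open>Truncated subtraction of \<open>q xs\<close> from \<open>p xs\<close> already yields the
  positive part of the numerator.\<close>

lemma computable_rat_pos_part:
  assumes "computable_rat k f"
  shows "computable_rat k (\<lambda>xs. max 0 (f xs))"
proof -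
  obtain p q d where f: "computable k p" "computable k q" "computable k d"
    "\<And>xs. length xs = k \<Longrightarrow> f xs = (of_nat (p xs) - of_nat (q xs)) / of_nat (Suc (d xs))"
    using assms(1) unfolding computable_rat_def by blast
  show ?thesis
  proof (rule computable_ratI)
    show "max 0 (f xs) = (of_nat (p xs - q xs) - of_nat 0) / of_nat (Suc (d xs))"
      if "length xs = k" for xs
      unfolding f(4)[OF that]
      by (cases "p xs \<le> q xs") (auto simp: max_def of_nat_diff divide_le_0_iff zero_le_divide_iff
          simp del: of_nat_Suc)
  qed (intro computable_intros f)+
qed

text \<open>Denominators are positive, so the sign is decided by comparing the natural numbers
  \<open>p xs\<close> and \<open>q xs\<close>.\<close>

lemma computable_if_rat_pos:
  assumes "computable_rat k f" "computable k u" "computable k v"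
  shows "computable k (\<lambda>xs. if 0 < f xs then u xs else v xs)"
proof -
  obtain p q d where f: "computable k p" "computable k q" "computable k d"
    "\<And>xs. length xs = k \<Longrightarrow> f xs = (of_nat (p xs) - of_nat (q xs)) / of_nat (Suc (d xs))"
    using assms(1) unfolding computable_rat_def by blast
  have "computable k (\<lambda>xs. if q xs < p xs then u xs else v xs)"
    by (intro computable_intros f assms)
  then show ?thesis
    by (rule computable_cong) (simp add: f(4) zero_less_divide_iff del: of_nat_Suc)
qed

lemma computable_rat_sum:
  assumes "computable_rat (Suc k) (\<lambda>ys. F (hd ys) (tl ys))" "computable k N"
  shows "computable_rat k (\<lambda>xs. \<Sum>i<N xs. F i xs)"
proof -
  obtain p q d where f: "computable (Suc k) p" "computable (Suc k) q" "computable (Suc k) d"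
    "\<And>ys. length ys = Suc k \<Longrightarrow>
       F (hd ys) (tl ys) = (of_nat (p ys) - of_nat (q ys)) / of_nat (Suc (d ys))"
    using assms(1) unfolding computable_rat_def by blast
  have F: "F i xs = (of_nat (p (i # xs)) - of_nat (q (i # xs))) / of_nat (Suc (d (i # xs)))"
    if "length xs = k" for i xs
    using f(4)[of "i # xs"] that by simp
  have cons: "computable (Suc k) (\<lambda>ys. h (hd ys # tl ys))" if "computable (Suc k) h" for h :: "nat list \<Rightarrow> nat"
    using that by (rule computable_cong) (auto simp: length_Suc_conv)
  \<comment> \<open>With a common denominator the sum reduces to sums of natural numbers.\<close>
  define D where "D = (\<lambda>xs. \<Prod>i<N xs. Suc (d (i # xs)))"
  have D: "computable k D"
    unfolding D_def by (intro computable_prod computable_Suc cons f assms)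
  have numer: "computable k (\<lambda>xs. \<Sum>i<N xs. h (i # xs) * (D xs div Suc (d (i # xs))))"
    if "computable (Suc k) h" for h
    by (intro computable_sum computable_mult computable_div computable_Suc computable_tl
        cons D f assms that) auto
  show ?thesis
  proof (rule computable_ratI[OF numer[OF f(1)] numer[OF f(2)] computable_diff[OF D computable_const[of _ 1]]])
    fix xs :: "nat list" assume xs: "length xs = k"
    have D_pos: "0 < D xs" unfolding D_def by (auto intro!: prod_pos)
    have term_eq: "F i xs = (of_nat (p (i # xs) * (D xs div Suc (d (i # xs))))
        - of_nat (q (i # xs) * (D xs div Suc (d (i # xs))))) / of_nat (D xs)" if "i < N xs" for i
    proof -
      \<comment> \<open>This denominator is one of the factors of \<open>D xs\<close>, so the
        integer division in the numerators is exact.\<close>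
      have "Suc (d (i # xs)) dvd D xs" unfolding D_def using that by (intro dvd_prodI) auto
      then obtain e where D_eq: "D xs = Suc (d (i # xs)) * e" by blast
      then have e: "D xs div Suc (d (i # xs)) = e" "0 < e"
        using D_pos by (auto simp del: mult_Suc)
      show ?thesis
        unfolding F[OF xs] e(1) unfolding D_eq of_nat_mult
        using e(2) by (simp add: left_diff_distrib[symmetric] del: of_nat_Suc)
    qed
    have "Suc (D xs - 1) = D xs" using D_pos by simp
    then show "(\<Sum>i<N xs. F i xs) = (of_nat (\<Sum>i<N xs. p (i # xs) * (D xs div Suc (d (i # xs))))
        - of_nat (\<Sum>i<N xs. q (i # xs) * (D xs div Suc (d (i # xs))))) / of_nat (Suc (D xs - 1))"
      by (simp only: of_nat_sum sum_subtractf[symmetric] sum_divide_distrib)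
        (rule sum.cong; simp only: term_eq lessThan_iff)
  qed
qed

lemma computable_rat_Max:
  assumes F: "computable_rat (Suc k) (\<lambda>ys. F (hd ys) (tl ys))" and N: "computable k N"
  shows "computable_rat k (\<lambda>xs. Max ((\<lambda>i. F i xs) ` {..N xs}))"
proof -
  \<comment> \<open>The index of the maximum is a natural number, so it is accessible to primitive recursion.\<close>
  define J where "J = (\<lambda>xs. rec_nat 0 (\<lambda>n y. if 0 < F (Suc n) xs - F y xs then Suc n else y))"
  \<comment> \<open>Substitutes a computed index and a parameter list given entrywise:
    \<open>tl (tl ys)\<close> inside the recursion, \<open>xs\<close> itself afterwards.\<close>
  have subst: "computable_rat k' (\<lambda>ys. F (h ys) (t ys))"
    if "computable k' h" "\<And>i. i < k \<Longrightarrow> computable k' (\<lambda>ys. t ys ! i)"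
      "\<And>ys. length ys = k' \<Longrightarrow> length (t ys) = k" for k' h t
  proof -
    have "computable_rat k' (\<lambda>xs. (\<lambda>ys. F (hd ys) (tl ys))
        (map (\<lambda>g. g xs) (h # map (\<lambda>i ys. t ys ! i) [0..<k])))"
      by (rule computable_rat_comp) (use F that in auto)
    then show ?thesis
      by (rule computable_rat_cong) (simp add: o_def, metis map_nth that(3))
  qed
  have proj: "computable (Suc (Suc k)) (\<lambda>ys. tl (tl ys) ! i)" if "i < k" for i
    using computable_tl[OF computable_tl_nth[OF that]] .
  have "computable k (\<lambda>xs. J xs (N xs))"
    unfolding J_def
    by (intro computable_rec_nat computable_if_rat_pos computable_rat_diff subst proj N
        computable_intros computable_hd_tl) auto
  then have "computable_rat k (\<lambda>xs. F (J xs (N xs)) xs)"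
    by (rule subst) (auto intro: computable_proj)
  moreover have "F (J xs n) xs = Max ((\<lambda>i. F i xs) ` {..n})" for xs n
  proof (induction n)
    case (Suc n)
    have J: "J xs (Suc n) = (if 0 < F (Suc n) xs - F (J xs n) xs then Suc n else J xs n)"
      by (simp add: J_def)
    show ?case
      by (simp add: atMost_Suc Max_insert J Suc.IH[symmetric] max_def)
  qed (simp add: J_def)
  ultimately show ?thesis by simp
qed

section \<open>Domination of increasing approximations\<close>

definition running_max :: "(nat \<Rightarrow> 'a::linorder) \<Rightarrow> nat \<Rightarrow> 'a" where
  "running_max g s = Max (g ` {..s})"

text \<open>Links the two views of the test: its endpoints have to be computable rationals, while
  covering and measure are treated over the reals.\<close>

lemma of_rat_running_max:
  "(of_rat (running_max g s) :: real) = running_max (\<lambda>t. of_rat (g t)) s"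
proof -
  have "mono (of_rat :: rat \<Rightarrow> real)" by (simp add: mono_def of_rat_less_eq)
  then have "(of_rat (Max (g ` {..s})) :: real) = Max (of_rat ` g ` {..s})"
    by (rule mono_Max_commute) auto
  then show ?thesis by (simp add: running_max_def image_image)
qed

text \<open>The intervals start at \<open>c s\<close> instead of \<open>c (Suc s)\<close> so that they overlap and leave no
  endpoint uncovered.\<close>

lemma mem_running_max_interval:
  fixes a c :: "nat \<Rightarrow> real"
  assumes a: "incseq a" "a \<longlonglongrightarrow> \<alpha>" and c: "strict_mono c" "c \<longlonglongrightarrow> \<beta>" and \<epsilon>: "0 < \<epsilon>"
    and big: "\<alpha> - \<epsilon> * \<beta> < a s\<^sub>1 - \<epsilon> * c (Suc s\<^sub>1)"
  defines "R \<equiv> running_max (\<lambda>t. a t - \<epsilon> * c (Suc t))"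
  shows "\<exists>s. \<alpha> \<in> {R s + \<epsilon> * c s <..< R s + \<epsilon> * c (s + 2)}"
proof -
  define g where "g t = a t - \<epsilon> * c (Suc t)" for t
  have "g \<longlonglongrightarrow> \<alpha> - \<epsilon> * \<beta>"
    unfolding g_def by (intro tendsto_intros a LIMSEQ_Suc c)
  then have "\<forall>\<^sub>F t in sequentially. g t < g s\<^sub>1"
    using big unfolding g_def by (rule order_tendstoD)
  then obtain S where S: "\<And>t. S \<le> t \<Longrightarrow> g t < g s\<^sub>1"
    by (auto simp: eventually_sequentially)
  \<comment> \<open>Beyond \<open>S\<close> all values of \<open>g\<close> lie below
    \<open>g s\<^sub>1\<close>, so the maximum over this finite range is the global one.\<close>
  have "Max (g ` {..max S s\<^sub>1}) \<in> g ` {..max S s\<^sub>1}" by (rule Max_in) auto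
  then obtain s\<^sub>0 where s0: "g s\<^sub>0 = Max (g ` {..max S s\<^sub>1})" by (metis imageE)
  have g_le: "g t \<le> g s\<^sub>0" for t
  proof (cases "t \<le> max S s\<^sub>1")
    case True
    then show ?thesis by (simp add: s0)
  next
    case False
    then have "g t < g s\<^sub>1" by (intro S) simp
    also have "g s\<^sub>1 \<le> g s\<^sub>0" by (simp add: s0)
    finally show ?thesis by simp
  qed
  have R: "R s = g s\<^sub>0" if "s\<^sub>0 \<le> s" for s
    unfolding R_def running_max_def g_def[symmetric] using that g_le by (intro Max_eqI) auto
  \<comment> \<open>The left-hand side is just \<open>a s\<^sub>0\<close>.\<close>
  have lower: "g s\<^sub>0 + \<epsilon> * c (Suc s\<^sub>0) \<le> \<alpha>"
    using incseq_le[OF a, of s\<^sub>0] by (simp add: g_def)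
  have "\<alpha> < g s\<^sub>0 + \<epsilon> * \<beta>" using big g_le[of s\<^sub>1] by (simp add: g_def)
  moreover have "(\<lambda>s. g s\<^sub>0 + \<epsilon> * c s) \<longlonglongrightarrow> g s\<^sub>0 + \<epsilon> * \<beta>" by (intro tendsto_intros c)
  ultimately have "\<forall>\<^sub>F s in sequentially. \<alpha> < g s\<^sub>0 + \<epsilon> * c s" by (intro order_tendstoD)
  then obtain s' where s': "\<alpha> < g s\<^sub>0 + \<epsilon> * c s'"
    by (auto simp: eventually_sequentially)
  \<comment> \<open>The first stage at which \<alpha> is exceeded comes after
    \<open>Suc s\<^sub>0\<close>. Hence it is \<open>d + 2\<close> with
    \<open>s\<^sub>0 \<le> d\<close>, where \<open>R d\<close> has its final value.\<close>
  define s where "s = (LEAST s. \<alpha> < g s\<^sub>0 + \<epsilon> * c s)"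
  have s: "\<alpha> < g s\<^sub>0 + \<epsilon> * c s" unfolding s_def using s' by (rule LeastI)
  have "Suc s\<^sub>0 < s"
  proof (rule ccontr)
    assume "\<not> Suc s\<^sub>0 < s"
    then have "\<epsilon> * c s \<le> \<epsilon> * c (Suc s\<^sub>0)" using c(1) \<epsilon> by (simp add: strict_mono_less_eq)
    then show False using s lower by simp
  qed
  then obtain d where d: "s = Suc (Suc d)" "s\<^sub>0 \<le> d"
    by (metis Suc_leI Suc_le_D Suc_le_mono)
  have "g s\<^sub>0 + \<epsilon> * c (Suc d) \<le> \<alpha>"
    using not_less_Least[of "Suc d" "\<lambda>s. \<alpha> < g s\<^sub>0 + \<epsilon> * c s"] d(1) by (simp add: s_def[symmetric] not_less)
  \<comment> \<open>\<alpha> may coincide with the value at \<open>Suc d\<close>; strict growth of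
    \<open>c\<close> puts it strictly above the value at \<open>d\<close>.\<close>
  moreover have "\<epsilon> * c d < \<epsilon> * c (Suc d)" using c(1) \<epsilon> by (simp add: strict_mono_less)
  ultimately have "\<alpha> \<in> {R d + \<epsilon> * c d <..< R d + \<epsilon> * c (d + 2)}"
    using s d by (simp add: R)
  then show ?thesis ..
qed

text \<open>Only the lengths matter, whatever the shifts \<open>R s\<close> are. Each interval spans
  two increments of \<open>c\<close>, so every increment is counted at most twice and the sum
  telescopes.\<close>

lemma emeasure_UN_intervals_le:
  fixes c R :: "nat \<Rightarrow> real"
  assumes c: "incseq c" "\<And>s. c s \<le> \<beta>" and \<epsilon>: "0 \<le> \<epsilon>"
  shows "emeasure lborel (\<Union>s. {R s + \<epsilon> * c s <..< R s + \<epsilon> * c (s + 2)})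
    \<le> ennreal (2 * \<epsilon> * (\<beta> - c 0))"
proof -
  let ?I = "\<lambda>s. {R s + \<epsilon> * c s <..< R s + \<epsilon> * c (s + 2)}"
  have le: "\<epsilon> * c s \<le> \<epsilon> * c (s + 2)" for s
    using c(1) \<epsilon> by (simp add: incseqD mult_left_mono)
  have partial: "(\<Sum>s<n. emeasure lborel (?I s)) \<le> ennreal (2 * \<epsilon> * (\<beta> - c 0))" for n
  proof -
    have "(\<Sum>s<n. emeasure lborel (?I s)) = (\<Sum>s<n. ennreal (\<epsilon> * c (s + 2) - \<epsilon> * c s))"
      using le by (intro sum.cong) auto
    also have "\<dots> = ennreal (\<Sum>s<n. \<epsilon> * c (s + 2) - \<epsilon> * c s)"
      using le by (intro sum_ennreal) auto
    also have "(\<Sum>s<n. \<epsilon> * c (s + 2) - \<epsilon> * c s) = \<epsilon> * (c (Suc n) + c n - c 0 - c 1)"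
      by (induction n) (auto simp: algebra_simps)
    also have "\<dots> \<le> \<epsilon> * (\<beta> + \<beta> - c 0 - c 0)"
      using c(2)[of n] c(2)[of "Suc n"] incseqD[OF c(1), of 0 1] \<epsilon> by (intro mult_left_mono) auto
    finally show ?thesis by (simp add: algebra_simps ennreal_leI)
  qed
  have "emeasure lborel (\<Union>s. ?I s) \<le> (\<Sum>s. emeasure lborel (?I s))"
    by (intro emeasure_subadditive_countably) auto
  also have "\<dots> \<le> ennreal (2 * \<epsilon> * (\<beta> - c 0))"
    using partial by (intro suminf_le_const) auto
  finally show ?thesis .
qed

lemma random_increasing_seq_dominates:
  fixes a c :: "nat \<Rightarrow> rat" and \<alpha> \<beta> :: real
  assumes a: "computable_rat_seq a" "incseq a" "(\<lambda>i. of_rat (a i)) \<longlonglongrightarrow> \<alpha>"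
    and random: "martin_loef_random \<alpha>"
    and c: "computable_rat_seq c" "strict_mono c" "(\<lambda>i. of_rat (c i)) \<longlonglongrightarrow> \<beta>"
  shows "\<exists>d. \<forall>s. \<beta> - of_rat (c (Suc s)) \<le> 2 ^ d * (\<alpha> - of_rat (a s))"
proof -
  let ?a = "\<lambda>i. of_rat (a i) :: real" and ?c = "\<lambda>i. of_rat (c i) :: real"
  have a': "incseq ?a" using a(2) by (simp add: incseq_def of_rat_less_eq)
  have c': "strict_mono ?c" using c(2) by (simp add: strict_mono_def of_rat_less)
  have c'': "incseq ?c" using strict_mono_mono[OF c'] .
  have c_le: "?c s \<le> \<beta>" for s using incseq_le[OF c'' c(3)] .
  \<comment> \<open>The offset \<open>e\<close> absorbs the factor
    \<open>2 * (\<beta> - ?c 0)\<close> of the measure bound, so that level \<open>n\<close> of the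
    test has measure at most \<open>1 / 2 ^ n\<close>.\<close>
  obtain e :: nat where "2 * (\<beta> - ?c 0) < 2 ^ e"
    using real_arch_pow[of 2] by auto
  define \<epsilon> :: "nat \<Rightarrow> rat" where "\<epsilon> n = 1 / of_nat (2 ^ (n + e))" for n
  have \<epsilon>_pos: "0 < (of_rat (\<epsilon> n) :: real)" for n
    by (simp add: \<epsilon>_def)
  have \<epsilon>_eq: "(of_rat (\<epsilon> n) :: real) = 1 / 2 ^ (n + e)" for n
    by (simp add: \<epsilon>_def of_rat_divide of_rat_power)
  define R where "R n = running_max (\<lambda>t. a t - \<epsilon> n * c (Suc t))" for n
  define l where "l n s = R n s + \<epsilon> n * c s" for n s
  define r where "r n s = R n s + \<epsilon> n * c (s + 2)" for n s
  define U where "U n = (\<Union>s. {of_rat (l n s) <..< (of_rat (r n s) :: real)})" for n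
  have comp_\<epsilon>: "computable_rat k (\<lambda>xs. \<epsilon> (f xs))" if "computable k f" for k f
    unfolding \<epsilon>_def
    by (intro computable_rat_inverse_of_nat computable_intros that) auto
  have comp_R: "computable_rat 2 (\<lambda>xs. R (xs ! 0) (xs ! 1))"
    unfolding R_def running_max_def numeral_2_eq_2
    by (intro computable_rat_Max computable_rat_diff computable_rat_mult comp_\<epsilon>
        computable_rat_seq_comp[OF a(1)] computable_rat_seq_comp[OF c(1)] computable_intros) auto
  have comp_l: "computable_rat_seq2 l"
    unfolding computable_rat_seq2_def l_def
    by (intro computable_rat_add computable_rat_mult comp_R comp_\<epsilon> computable_rat_seq_comp[OF c(1)]
        computable_intros) auto
  have comp_r: "computable_rat_seq2 r"
    unfolding computable_rat_seq2_def r_def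
    by (intro computable_rat_add computable_rat_mult comp_R comp_\<epsilon> computable_rat_seq_comp[OF c(1)]
        computable_intros) auto
  define R' where "R' n = running_max (\<lambda>t. ?a t - of_rat (\<epsilon> n) * ?c (Suc t))" for n
  have U: "U n = (\<Union>s. {R' n s + of_rat (\<epsilon> n) * ?c s <..< R' n s + of_rat (\<epsilon> n) * ?c (s + 2)})" for n
    by (simp add: U_def l_def r_def R_def R'_def of_rat_add of_rat_mult of_rat_diff of_rat_running_max)
  have "emeasure lborel (U n) \<le> ennreal (1 / 2 ^ n)" for n
  proof -
    have "emeasure lborel (U n) \<le> ennreal (2 * of_rat (\<epsilon> n) * (\<beta> - ?c 0))"
      unfolding U using \<epsilon>_pos[of n] by (intro emeasure_UN_intervals_le c'' c_le) simp
    also have "2 * of_rat (\<epsilon> n) * (\<beta> - ?c 0) = (2 * (\<beta> - ?c 0)) / 2 ^ e / 2 ^ n"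
      by (simp add: \<epsilon>_eq power_add)
    also have "\<dots> \<le> 1 / 2 ^ n"
      using \<open>2 * (\<beta> - ?c 0) < 2 ^ e\<close> by (intro divide_right_mono) auto
    finally show ?thesis by (simp add: ennreal_leI)
  qed
  then have "martin_loef_test U"
    unfolding martin_loef_test_def using comp_l comp_r U_def by blast
  \<comment> \<open>A level that misses \<alpha> fixes the constant: \<open>2 ^ (n + e)\<close> is
    the reciprocal of \<open>\<epsilon> n\<close>, and a violation at any \<open>s\<close> would put
    \<alpha> into \<open>U n\<close>.\<close>
  then obtain n where n: "\<alpha> \<notin> U n"
    using random unfolding martin_loef_random_def by blast
  have "\<beta> - ?c (Suc s) \<le> 2 ^ (n + e) * (\<alpha> - ?a s)" for s
  proof (rule ccontr)
    assume "\<not> ?thesis"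
    then have "\<alpha> - ?a s < (\<beta> - ?c (Suc s)) / 2 ^ (n + e)"
      by (simp add: pos_less_divide_eq mult.commute)
    then have "\<alpha> - of_rat (\<epsilon> n) * \<beta> < ?a s - of_rat (\<epsilon> n) * ?c (Suc s)"
      by (simp add: \<epsilon>_eq diff_divide_distrib)
    from mem_running_max_interval[OF a' a(3) c' c(3) \<epsilon>_pos this] show False
      using n unfolding U R'_def by blast
  qed
  then show ?thesis by blast
qed

text \<open>\<open>c s\<close> only counts the weights of indices below \<open>s - 1\<close>, so all of the mass beyond \<open>N\<close> is
  still missing from \<open>c (N + 2)\<close>; subtracting \<open>1 / (s + 1)\<close> makes \<open>c\<close> strictly increasing.\<close>

lemma semimeasure_tail_less:
  fixes m :: "nat \<Rightarrow> real"
  assumes m: "lower_semicomputable_semimeasure m"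
  obtains c :: "nat \<Rightarrow> rat" and \<beta> :: real where
    "computable_rat_seq c" "strict_mono c" "(\<lambda>s. of_rat (c s)) \<longlonglongrightarrow> \<beta>"
    "\<And>N. (\<Sum>\<^sub>\<infinity>n\<in>{N<..}. m n) < \<beta> - of_rat (c (N + 2))"
proof -
  obtain q where q: "computable_rat_seq2 q" "\<And>n. incseq (q n)" "\<And>n. (\<lambda>s. of_rat (q n s)) \<longlonglongrightarrow> m n"
    using m unfolding lower_semicomputable_semimeasure_def lower_semicomputable_def by blast
  have m_nonneg: "0 \<le> m n" for n
    using m unfolding lower_semicomputable_semimeasure_def by blast
  have m_sum: "m summable_on UNIV"
    using m unfolding lower_semicomputable_semimeasure_def by blast
  \<comment> \<open>Early approximations may be negative. Cutting them off at 0 keeps the limit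
    \<open>m n\<close> and lets \<open>b\<close> grow when further terms enter the sum.\<close>
  define p where "p n s = max 0 (q n s)" for n s
  define b where "b s = (\<Sum>i<s - 1. p i s)" for s
  define c where "c s = b s - 1 / of_nat (Suc s)" for s
  have p_mono: "p n s \<le> p n t" if "s \<le> t" for n s t
    using incseqD[OF q(2) that] by (auto simp: p_def max_def intro: order_trans)
  have p_nonneg: "0 \<le> p n s" for n s by (simp add: p_def)
  have of_rat_max: "(of_rat (max x y) :: real) = max (of_rat x) (of_rat y)" for x y
    by (simp add: max_def of_rat_less_eq)
  have p_lim: "(\<lambda>s. of_rat (p n s)) \<longlonglongrightarrow> m n" for n
  proof -
    have "(\<lambda>s. max 0 (of_rat (q n s))) \<longlonglongrightarrow> max 0 (m n)" by (intro tendsto_max q tendsto_const)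
    then show ?thesis using m_nonneg[of n] by (simp add: p_def of_rat_max)
  qed
  have p_le: "(of_rat (p n s) :: real) \<le> m n" for n s
    by (rule incseq_le[OF _ p_lim]) (simp add: incseq_def of_rat_less_eq p_mono)
  have b_mono: "b s \<le> b t" if "s \<le> t" for s t
  proof -
    have "b s \<le> (\<Sum>i<s - 1. p i t)" unfolding b_def using that by (intro sum_mono p_mono)
    also have "\<dots> \<le> b t" unfolding b_def using that by (intro sum_mono2) (auto simp: p_nonneg)
    finally show ?thesis .
  qed
  have sum_le: "(\<Sum>i<n. m i) \<le> infsum m UNIV" for n
    using m_sum m_nonneg by (intro finite_sum_le_infsum) auto
  have b_le: "(of_rat (b s) :: real) \<le> (\<Sum>i<s - 1. m i)" for s
    by (auto simp: b_def of_rat_sum intro!: sum_mono p_le)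
  have m_sums: "(\<lambda>n. \<Sum>i<n. m i) \<longlonglongrightarrow> infsum m UNIV"
    using has_sum_imp_sums[OF has_sum_infsum[OF m_sum]] by (simp add: sums_def)
  have b_lim: "(\<lambda>s. of_rat (b s)) \<longlonglongrightarrow> infsum m UNIV"
  \<comment> \<open>For the lower bound, finitely many terms \<open>m i\<close> already sum to more
    than \<open>x\<close>; once all of them are counted, their approximations eventually do so as
    well.\<close>
  proof (rule increasing_tendsto)
    show "\<forall>\<^sub>F s in sequentially. of_rat (b s) \<le> infsum m UNIV"
      using order_trans[OF b_le sum_le] by simp
    fix x assume "x < infsum m UNIV"
    then obtain K where K: "x < (\<Sum>i<K. m i)"
      using order_tendstoD(1)[OF m_sums] by (auto simp: eventually_sequentially)
    have "(\<lambda>s. \<Sum>i<K. of_rat (p i s)) \<longlonglongrightarrow> (\<Sum>i<K. m i)" by (intro tendsto_sum p_lim)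
    then have "\<forall>\<^sub>F s in sequentially. x < (\<Sum>i<K. of_rat (p i s))" using K by (rule order_tendstoD)
    moreover have "\<forall>\<^sub>F s in sequentially. (\<Sum>i<K. of_rat (p i s)) \<le> (of_rat (b s) :: real)"
      using eventually_ge_at_top[of "Suc K"]
    proof eventually_elim
      case (elim s)
      then have "(\<Sum>i<K. p i s) \<le> b s" unfolding b_def by (intro sum_mono2) (auto simp: p_nonneg)
      then show ?case by (simp add: of_rat_less_eq flip: of_rat_sum)
    qed
    ultimately show "\<forall>\<^sub>F s in sequentially. x < of_rat (b s)" by eventually_elim simp
  qed
  have "computable_rat_seq c"
    unfolding computable_rat_seq_def c_def b_def p_def One_nat_def
    by (intro computable_rat_diff computable_rat_sum computable_rat_pos_part
        computable_rat_seq2_comp[OF q(1)] computable_rat_inverse_of_nat computable_intros) auto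
  moreover have "strict_mono c"
    unfolding strict_mono_Suc_iff
  proof
    fix s
    have "1 / of_nat (Suc (Suc s)) < (1 / of_nat (Suc s) :: rat)" by (simp add: frac_less2)
    then show "c s < c (Suc s)" unfolding c_def using b_mono[of s "Suc s"] by simp
  qed
  moreover have "(\<lambda>s. of_rat (c s)) \<longlonglongrightarrow> infsum m UNIV"
  proof -
    have "(\<lambda>s. of_rat (b s) - 1 / real (Suc s)) \<longlonglongrightarrow> infsum m UNIV - 0"
      by (intro tendsto_diff b_lim LIMSEQ_Suc[OF lim_1_over_n])
    then show ?thesis by (simp add: c_def of_rat_diff of_rat_divide of_rat_add)
  qed
  moreover have "(\<Sum>\<^sub>\<infinity>n\<in>{N<..}. m n) < infsum m UNIV - of_rat (c (N + 2))" for N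
  proof -
    \<comment> \<open>At stage \<open>N + 2\<close> the sum \<open>b\<close> runs over the indices
      below \<open>Suc N\<close>, which are exactly those outside the tail.\<close>
    have "infsum m UNIV = infsum m ({..<Suc N} \<union> {N<..})"
      by (rule arg_cong[where f = "infsum m"]) auto
    also have "\<dots> = (\<Sum>i<Suc N. m i) + (\<Sum>\<^sub>\<infinity>n\<in>{N<..}. m n)"
      by (subst infsum_Un_disjoint)
        (auto intro: summable_on_subset_banach[OF m_sum] simp del: sum.lessThan_Suc lessThan_Suc)
    finally have "(\<Sum>\<^sub>\<infinity>n\<in>{N<..}. m n) \<le> infsum m UNIV - of_rat (b (N + 2))"
      using b_le[of "N + 2"] by simp
    moreover have "c (N + 2) < b (N + 2)" by (simp add: c_def)
    ultimately show ?thesis by (smt (verit) of_rat_less)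
  qed
  ultimately show ?thesis by (rule that)
qed

section \<open>From the missing mass to the modulus of convergence\<close>

theorem theorem14:
  fixes m :: "nat \<Rightarrow> real" and a :: "nat \<Rightarrow> rat" and \<alpha> :: real
  assumes "universal_semimeasure m"
    and "computable_rat_seq a"
    and "incseq a"
    and "(\<lambda>i. of_rat (a i)) \<longlonglongrightarrow> \<alpha>"
    and "martin_loef_random \<alpha>"
  shows "\<exists>c::int. \<forall>k::nat.
    modulus_of_convergence (\<lambda>i. of_rat (a i)) \<alpha> (2 powi (- int k)) \<ge> BP' m (int k - c)"
proof -
  obtain c \<beta> where c: "computable_rat_seq c" "strict_mono c" "(\<lambda>s. of_rat (c s)) \<longlonglongrightarrow> \<beta>"
    and tail: "\<And>N. (\<Sum>\<^sub>\<infinity>n\<in>{N<..}. m n) < \<beta> - of_rat (c (N + 2))"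
    using assms(1) semimeasure_tail_less unfolding universal_semimeasure_def by blast
  obtain d where d: "\<And>s. \<beta> - of_rat (c (Suc s)) \<le> 2 ^ d * (\<alpha> - of_rat (a s))"
    using random_increasing_seq_dominates[OF assms(2-5) c] by blast
  have "BP' m (int k - int d)
      \<le> modulus_of_convergence (\<lambda>i. of_rat (a i)) \<alpha> (2 powi (- int k))" for k
  proof -
    define \<delta> :: real where "\<delta> = 2 powi (- int k)"
    define N where "N = modulus_of_convergence (\<lambda>i. of_rat (a i)) \<alpha> \<delta>"
    have "0 < \<delta>" by (simp add: \<delta>_def)
    \<comment> \<open>Convergence provides some such \<open>N\<close>, without which the
      \<open>LEAST\<close> in the modulus would carry no information.\<close>
    then have "\<exists>N. \<forall>n>N. \<bar>\<alpha> - of_rat (a n)\<bar> < \<delta>"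
      using LIMSEQ_D[OF assms(4), of \<delta>] by (metis abs_minus_commute less_imp_le real_norm_def)
    then have "\<forall>n>N. \<bar>\<alpha> - of_rat (a n)\<bar> < \<delta>"
      unfolding N_def modulus_of_convergence_def by (rule LeastI_ex)
    \<comment> \<open>\<open>Suc N\<close> is the first index that the modulus controls. The
      domination at \<open>s = Suc N\<close> concerns \<open>c (N + 2)\<close>, exactly the stage in
      \<open>tail\<close>.\<close>
    then have "\<alpha> - of_rat (a (Suc N)) < \<delta>" by (metis abs_ge_self le_less_trans lessI)
    then have "2 ^ d * (\<alpha> - of_rat (a (Suc N))) < 2 ^ d * \<delta>" by simp
    also have "2 ^ d * \<delta> = 2 powi (- (int k - int d))"
      by (simp add: \<delta>_def power_int_diff power_int_minus field_simps)
    finally have "(\<Sum>\<^sub>\<infinity>n\<in>{N<..}. m n) < 2 powi (- (int k - int d))"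
      using tail[of N] d[of "Suc N"] by simp
    then show ?thesis
      unfolding BP'_def N_def[unfolded \<delta>_def, symmetric] by (rule Least_le)
  qed
  then show ?thesis by blast
qed

end
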